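(* Let $\mathcal{F}$ be a class of convex objectives on $\mathcal{X}$, let $d:\mathcal{X}\times\mathcal{X}\to\mathbb{R}$, let $\lambda>0$, $\Delta>0$, $\epsilon>0$. For any optimization algorithm $\mathcal{A}$ and any $\theta>1$, the algorithm $\mathsf{Cvx}\to\mathsf{SC}(\mathcal{A},\theta)$ satisfies $$\mathsf{Time}_\lambda\big(\epsilon,\Delta,d,\mathcal{F},\mathsf{Cvx}\to\mathsf{SC}(\mathcal{A},\theta)\big)\ \leq\ \sum_{t=1}^{\lceil \log_\theta\frac{\Delta}{\epsilon}\rceil}\mathsf{Time}\Big(\theta^{-t}\Delta,\ \theta^{1-t}\frac{\Delta}{\lambda},\ d,\ \mathcal{F},\ \mathcal{A}\Big).$$
   Context: Growth condition: for $d:\mathcal{X}\times\mathcal{X}\to\mathbb{R}$, $F$ satisfies the $(\lambda,d)$-growth condition ($(\lambda,d)$-GC) if there is a mapping $x^*:\mathcal{X}\to\mathcal{X}$ such that $F(x^*(x))=F^*=\min_{x}F(x)$ for all $x\in\mathcal{X}$ and $F(x)-F^*\ge\lambda\, d(x,x^*(x))$ for all $x\in\mathcal{X}$. $\mathsf{Time}(\epsilon,B,d,\mathcal{F},\mathcal{A})$ is the time (e.g. number of iterations or oracle calls; an additive cost) needed by $\mathcal{A}$ to find a point $\hat x$ with $\mathbb{E}F(\hat x)-F^*\le\epsilon$ for any $F\in\mathcal{F}$, when provided with a (possibly random) point $x_0$ with $\mathbb{E}\,d(x_0,x^*(x_0))\le B$, where $x^*$ is a mapping into the minimizers of $F$.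 $\mathsf{Time}_\lambda(\epsilon,\Delta,d,\mathcal{F},\mathcal{A})$ is the time needed by $\mathcal{A}$ to find $\hat x$ with $\mathbb{E}F(\hat x)-F^*\le\epsilon$ for any $F\in\mathcal{F}$ that also satisfies the $(\lambda,d)$-GC, when provided with a (possibly random) point $x_0$ with $\mathbb{E}F(x_0)-F^*\le\Delta$. Algorithm $\mathsf{Cvx}\to\mathsf{SC}(\mathcal{A},\theta)$: given $x_0$ with $\mathbb{E}F(x_0)-F^*\le\Delta$, for $t=1,2,\dots,T=\lceil\log_\theta(\Delta/\epsilon)\rceil$ let $x_t$ be the output of $\mathcal{A}$ initialized at $x_{t-1}$ after running for $\mathsf{Time}(\theta^{-t}\Delta,\theta^{1-t}\Delta/\lambda,d,\mathcal{F},\mathcal{A})$; return $x_T$. *)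

theory Defs
  imports "HOL-Probability.Probability"
begin

(* Throughout, M is the domain X equipped with a sigma-algebra, i.e. X = space M, and a random
   point of X is represented by its law, an element of space (prob_algebra M). *)

(* Expectation in the extended reals of a real random variable of either sign. In ereal,
   infinity - infinity = infinity, so an upper bound on an undefined expectation never holds.
   (The Bochner integral would return 0 in that case and on infinite expectations.) *)
definition ext_expect :: "'a measure \<Rightarrow> ('a \<Rightarrow> real) \<Rightarrow> ereal" where
  "ext_expect \<mu> f =
     enn2ereal (\<integral>\<^sup>+x. ennreal (f x) \<partial>\<mu>) - enn2ereal (\<integral>\<^sup>+x. ennreal (- f x) \<partial>\<mu>)"

lemma ext_expect_eq_integral:
  assumes "integrable \<mu> f"
  shows "ext_expect \<mu> f = ereal (integral\<^sup>L \<mu> f)"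
proof -
  have "(\<integral>\<^sup>+x. ennreal (f x) \<partial>\<mu>) < \<infinity>" "(\<integral>\<^sup>+x. ennreal (- f x) \<partial>\<mu>) < \<infinity>"
    using assms by (auto simp: real_integrable_def top.not_eq_extremum)
  then show ?thesis
    unfolding ext_expect_def real_lebesgue_integral_def[OF assms]
    by (cases "\<integral>\<^sup>+x. ennreal (f x) \<partial>\<mu>"; cases "\<integral>\<^sup>+x. ennreal (- f x) \<partial>\<mu>")
      (auto simp: enn2ereal_ennreal)
qed

definition min_value :: "'a set \<Rightarrow> ('a \<Rightarrow> real) \<Rightarrow> real" where
  "min_value X F = F (arg_min_on F X)"

(* Maps into the minimizers of F. The measurability clause only ensures that
   E d(x0, x*(x0)) makes sense for a random x0; neither d nor x* need be measurable. *)
definition minimizer_map ::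
  "'a measure \<Rightarrow> ('a \<Rightarrow> 'a \<Rightarrow> real) \<Rightarrow> ('a \<Rightarrow> real) \<Rightarrow> ('a \<Rightarrow> 'a) \<Rightarrow> bool" where
  "minimizer_map M d F xs \<longleftrightarrow>
     (\<forall>x\<in>space M. is_arg_min F (\<lambda>y. y \<in> space M) (xs x)) \<and>
     (\<lambda>x. d x (xs x)) \<in> borel_measurable M"

definition growth_condition ::
  "'a measure \<Rightarrow> real \<Rightarrow> ('a \<Rightarrow> 'a \<Rightarrow> real) \<Rightarrow> ('a \<Rightarrow> real) \<Rightarrow> bool" where
  "growth_condition M lam d F \<longleftrightarrow>
     (\<exists>xs. minimizer_map M d F xs \<and>
        (\<forall>x\<in>space M. F x - min_value (space M) F \<ge> lam * d x (xs x)))"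

(* A e b F n x is the law of the output of the algorithm when it is set up for target accuracy e
   and for the bound b on the quality of its initial point, is run for n units of time
   (iterations, oracle calls, ...) on the objective F, and is initialized at x. An algorithm
   that does not use e and b is constant in them. Only the input-output behaviour is recorded;
   the randomness may come from the algorithm or from a stochastic oracle for F. *)
type_synonym 'a alg = "real \<Rightarrow> real \<Rightarrow> ('a \<Rightarrow> real) \<Rightarrow> nat \<Rightarrow> 'a \<Rightarrow> 'a measure"

definition algorithm :: "'a measure \<Rightarrow> ('a \<Rightarrow> real) set \<Rightarrow> 'a alg \<Rightarrow> bool" where
  "algorithm M \<F> A \<longleftrightarrow> (\<forall>e b. \<forall>F\<in>\<F>. \<forall>n. A e b F n \<in> M \<rightarrow>\<^sub>M prob_algebra M)"

(* Time(e, B, d, F, A): least number of time units that suffices, infinity if none does. *)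
definition opt_time ::
  "'a measure \<Rightarrow> real \<Rightarrow> real \<Rightarrow> ('a \<Rightarrow> 'a \<Rightarrow> real) \<Rightarrow> ('a \<Rightarrow> real) set \<Rightarrow> 'a alg \<Rightarrow> enat" where
  "opt_time M e B d \<F> A =
     (INF n \<in> {n. \<forall>F\<in>\<F>. \<forall>xs. \<forall>\<mu>\<in>space (prob_algebra M).
                minimizer_map M d F xs \<and> ext_expect \<mu> (\<lambda>x. d x (xs x)) \<le> ereal B \<longrightarrow>
                ext_expect (\<mu> \<bind> A e B F n) F - ereal (min_value (space M) F) \<le> ereal e}.
        enat n)"

(* Time_lam(e, D, d, F, A): as before, on the objectives in the class that satisfy the (lam, d)-growth
   condition and with D a bound on the initial suboptimality. *)
definition opt_time_gc ::
  "'a measure \<Rightarrow> real \<Rightarrow> real \<Rightarrow> real \<Rightarrow> ('a \<Rightarrow> 'a \<Rightarrow> real) \<Rightarrow> ('a \<Rightarrow> real) set \<Rightarrow> 'a alg \<Rightarrow> enat" where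
  "opt_time_gc M lam e D d \<F> A =
     (INF n \<in> {n. \<forall>F\<in>\<F>. \<forall>\<mu>\<in>space (prob_algebra M).
                growth_condition M lam d F \<and>
                ext_expect \<mu> F - ereal (min_value (space M) F) \<le> ereal D \<longrightarrow>
                ext_expect (\<mu> \<bind> A e D F n) F - ereal (min_value (space M) F) \<le> ereal e}.
        enat n)"

(* Run the stages in the list one after the other, stage t being the kernel K t with duration
   \<tau> t, with n units of time in total: a run that is stopped during stage t outputs what
   stage t has produced so far, and a run that is past the last stage keeps its result. *)
fun run_stages ::
  "'a measure \<Rightarrow> (nat \<Rightarrow> enat) \<Rightarrow> (nat \<Rightarrow> nat \<Rightarrow> 'a \<Rightarrow> 'a measure) \<Rightarrow> nat list \<Rightarrow> nat \<Rightarrow> 'a \<Rightarrow> 'a measure"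
where
  "run_stages M \<tau> K [] n x = return M x"
| "run_stages M \<tau> K (t # ts) n x =
     (if \<tau> t \<le> enat n
      then K t (the_enat (\<tau> t)) x \<bind> run_stages M \<tau> K ts (n - the_enat (\<tau> t))
      else K t n x)"

(* The reduction Cvx->SC(A, th) for target accuracy e and initial bound D. *)
definition cvx_to_sc ::
  "'a measure \<Rightarrow> real \<Rightarrow> ('a \<Rightarrow> 'a \<Rightarrow> real) \<Rightarrow> ('a \<Rightarrow> real) set \<Rightarrow> 'a alg \<Rightarrow> real \<Rightarrow> 'a alg" where
  "cvx_to_sc M lam d \<F> A th = (\<lambda>e D F n x.
     run_stages M
       (\<lambda>t. opt_time M (th powr (- real t) * D) (th powr (1 - real t) * D / lam) d \<F> A)
       (\<lambda>t. A (th powr (- real t) * D) (th powr (1 - real t) * D / lam) F)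
       [1..<Suc (nat \<lceil>log th (D / e)\<rceil>)] n x)"

lemma measurable_run_stages:
  assumes "\<And>t n. K t n \<in> M \<rightarrow>\<^sub>M prob_algebra M"
  shows "run_stages M \<tau> K ts n \<in> M \<rightarrow>\<^sub>M prob_algebra M"
proof (induction ts arbitrary: n)
  case Nil
  have "(\<lambda>x. return M x) \<in> M \<rightarrow>\<^sub>M prob_algebra M"
    by (rule measurable_return_prob_space)
  moreover have "run_stages M \<tau> K [] n = (\<lambda>x. return M x)"
    by (rule ext) simp
  ultimately show ?case by simp
next
  case (Cons t ts)
  have "(\<lambda>x. K t (the_enat (\<tau> t)) x \<bind> run_stages M \<tau> K ts (n - the_enat (\<tau> t)))
          \<in> M \<rightarrow>\<^sub>M prob_algebra M"
    by (rule measurable_bind_prob_space[OF assms Cons.IH])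
  moreover have "run_stages M \<tau> K (t # ts) n =
      (if \<tau> t \<le> enat n
       then (\<lambda>x. K t (the_enat (\<tau> t)) x \<bind> run_stages M \<tau> K ts (n - the_enat (\<tau> t)))
       else K t n)"
    by (rule ext) simp
  ultimately show ?case using assms by simp
qed

lemma algorithm_cvx_to_sc:
  assumes "algorithm M \<F> A"
  shows "algorithm M \<F> (cvx_to_sc M lam d \<F> A th)"
  using assms unfolding algorithm_def cvx_to_sc_def
  by (auto intro!: measurable_run_stages)

end

theory Submission
  imports Defs
begin

text \<open>
  Write \<open>F*\<close> for the minimum of \<open>F\<close>. Under the growth condition,
  \<open>E d(x, x*(x)) \<le> (E F(x) - F*) / \<lambda>\<close>, so suboptimality at most \<open>\<theta>\<^sup>1\<^sup>-\<^sup>t \<Delta>\<close> before stage \<open>t\<close>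
  makes the input of that stage admissible for \<open>\<A>\<close>, whose guarantee is suboptimality
  at most \<open>\<theta>\<^sup>-\<^sup>t \<Delta>\<close> afterwards. After \<open>\<lceil>log\<^sub>\<theta> (\<Delta>/\<epsilon>)\<rceil>\<close> stages this is at most \<open>\<epsilon>\<close>.
\<close>

text \<open>The naturals are well-ordered, and finiteness of the infimum excludes the empty set. So
  a finite \<open>opt_time\<close> is itself a sufficient running time, and a stage run for exactly
  that long carries its guarantee.\<close>

lemma the_enat_INF_in:
  assumes "(INF n\<in>S. enat n) \<noteq> \<infinity>"
  shows "the_enat (INF n\<in>S. enat n) \<in> S"
proof -
  have "enat ` S \<noteq> {}"
    using assms by (auto simp: top_enat_def)
  then have "(INF n\<in>S. enat n) \<in> enat ` S"
    by (metis Inf_enat_def LeastI ex_in_conv)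
  then show ?thesis
    by auto
qed

text \<open>\<open>arg_min_on\<close> is a Hilbert choice, so it denotes a minimizer only once one
  is known to exist; \<open>z\<close> is that witness.\<close>

lemma min_value_eq:
  assumes "is_arg_min F (\<lambda>y. y \<in> X) z"
  shows "min_value X F = F z"
proof -
  have "is_arg_min F (\<lambda>y. y \<in> X) (arg_min_on F X)"
    unfolding arg_min_on_def arg_min_def using assms by (rule someI)
  with assms show ?thesis
    unfolding min_value_def is_arg_min_linorder by (meson order_antisym)
qed

text \<open>No integrability is assumed, since this is applied to d(x, x*(x)), which may be
  unbounded below with expectation minus infinity.\<close>

lemma ext_expect_mono:
  assumes "\<And>x. x \<in> space \<mu> \<Longrightarrow> f x \<le> g x"
  shows "ext_expect \<mu> f \<le> ext_expect \<mu> g"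
  unfolding ext_expect_def
  by (intro ereal_minus_mono less_eq_ennreal.rep_eq[THEN iffD1] nn_integral_mono
      ennreal_leI le_imp_neg_le assms)

text \<open>The lower bound makes the negative part finite. The positive part is then finite too,
  because infinity minus anything is infinity in \<open>ereal\<close>.\<close>

lemma integrable_of_ext_expect_less_PInf:
  assumes "finite_measure \<mu>" and f: "f \<in> borel_measurable \<mu>"
    and lower: "\<And>x. x \<in> space \<mu> \<Longrightarrow> c \<le> f x"
    and fin: "ext_expect \<mu> f < \<infinity>"
  shows "integrable \<mu> f"
proof -
  interpret finite_measure \<mu> by fact
  have "(\<integral>\<^sup>+x. ennreal (- f x) \<partial>\<mu>) \<le> (\<integral>\<^sup>+x. ennreal (- c) \<partial>\<mu>)"
    using lower by (intro nn_integral_mono ennreal_leI) auto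
  also have "\<dots> < \<infinity>"
    using emeasure_finite by (simp add: ennreal_mult_eq_top_iff less_top[symmetric])
  finally have neg: "(\<integral>\<^sup>+x. ennreal (- f x) \<partial>\<mu>) \<noteq> \<infinity>"
    by simp
  have "(\<integral>\<^sup>+x. ennreal (f x) \<partial>\<mu>) \<noteq> \<infinity>"
  proof
    assume "(\<integral>\<^sup>+x. ennreal (f x) \<partial>\<mu>) = \<infinity>"
    then show False
      using fin by (simp add: ext_expect_def)
  qed
  with neg f show ?thesis
    by (simp add: real_integrable_def)
qed

lemma ext_expect_dist_le:
  assumes \<mu>: "\<mu> \<in> space (prob_algebra M)" and F: "F \<in> borel_measurable M" and "lam > 0"
    and xs: "minimizer_map M d F xs"
    and growth: "\<And>x. x \<in> space M \<Longrightarrow> lam * d x (xs x) \<le> F x - min_value (space M) F"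
    and sub: "ext_expect \<mu> F - ereal (min_value (space M) F) \<le> ereal D"
  shows "ext_expect \<mu> (\<lambda>x. d x (xs x)) \<le> ereal (D / lam)"
proof -
  let ?m = "min_value (space M) F"
  interpret prob_space \<mu>
    using \<mu> by (simp add: space_prob_algebra)
  have sets: "sets \<mu> = sets M"
    using \<mu> by (simp add: space_prob_algebra)
  have space: "space \<mu> = space M"
    using sets by (rule sets_eq_imp_space_eq)
  have lower: "?m \<le> F x" if "x \<in> space M" for x
  proof -
    have "is_arg_min F (\<lambda>y. y \<in> space M) (xs x)"
      using xs that by (auto simp: minimizer_map_def)
    then show ?thesis
      using min_value_eq[of F "space M" "xs x"] that by (auto simp: is_arg_min_linorder)
  qed
  have "ext_expect \<mu> F < \<infinity>"
    using sub by (cases "ext_expect \<mu> F") auto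
  moreover have "F \<in> borel_measurable \<mu>"
    using F measurable_cong_sets[OF sets refl] by auto
  ultimately have int: "integrable \<mu> F"
    using lower space by (intro integrable_of_ext_expect_less_PInf[where c = ?m]) auto
  have le: "integral\<^sup>L \<mu> F - ?m \<le> D"
    using sub by (simp add: ext_expect_eq_integral[OF int])
  have "ext_expect \<mu> (\<lambda>x. d x (xs x)) \<le> ext_expect \<mu> (\<lambda>x. (F x - ?m) / lam)"
    using growth \<open>lam > 0\<close> space
    by (intro ext_expect_mono) (simp add: pos_le_divide_eq mult.commute)
  also have "\<dots> = ereal ((integral\<^sup>L \<mu> F - ?m) / lam)"
    using int by (subst ext_expect_eq_integral) (auto simp: prob_space)
  also have "\<dots> \<le> ereal (D / lam)"
    using le \<open>lam > 0\<close> by (simp add: divide_right_mono)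
  finally show ?thesis .
qed

text \<open>\<open>P t\<close> concerns the law just before stage \<open>t\<close>. The budget
  \<open>n\<close> is exactly the total duration, so no stage is cut short. The induction absorbs
  the first stage into the initial law by associativity of bind.\<close>

lemma bind_run_stages_invariant:
  assumes K: "\<And>t n. K t n \<in> M \<rightarrow>\<^sub>M prob_algebra M"
    and "a \<le> b"
    and fin: "\<And>t. a \<le> t \<Longrightarrow> t < b \<Longrightarrow> \<tau> t \<noteq> \<infinity>"
    and step: "\<And>t \<mu>. \<lbrakk>a \<le> t; t < b; \<mu> \<in> space (prob_algebra M); P t \<mu>\<rbrakk>
                 \<Longrightarrow> P (Suc t) (\<mu> \<bind> K t (the_enat (\<tau> t)))"
    and "\<mu> \<in> space (prob_algebra M)" and "P a \<mu>"
    and "n = (\<Sum>t=a..<b. the_enat (\<tau> t))"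
  shows "P b (\<mu> \<bind> run_stages M \<tau> K [a..<b] n)"
  using assms(2-)
proof (induction "b - a" arbitrary: a \<mu> n)
  case 0
  then have "a = b" by simp
  moreover have "\<mu> \<bind> return M = \<mu>"
    using 0 by (intro bind_return'') (simp add: space_prob_algebra)
  moreover have "run_stages M \<tau> K [] n = return M"
    by (rule ext) simp
  ultimately show ?case
    using 0 by simp
next
  case (Suc k)
  let ?k = "the_enat (\<tau> a)"
  let ?R = "run_stages M \<tau> K [Suc a..<b] (n - ?k)"
  have "a < b"
    using Suc.hyps by simp
  then have n: "n = ?k + (\<Sum>t=Suc a..<b. the_enat (\<tau> t))"
    using Suc.prems by (simp add: sum.atLeast_Suc_lessThan)
  \<comment> \<open>This selects the branch where the stage completes; finiteness is needed for
    \<open>the_enat\<close> to return the actual duration.\<close>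
  have "\<tau> a \<le> enat n"
    using Suc.prems(2)[of a] \<open>a < b\<close> n by (cases "\<tau> a") auto
  then have "run_stages M \<tau> K [a..<b] n = (\<lambda>x. K a ?k x \<bind> ?R)"
    using \<open>a < b\<close> by (intro ext) (simp add: upt_conv_Cons)
  moreover have "\<mu> \<bind> (\<lambda>x. K a ?k x \<bind> ?R) = (\<mu> \<bind> K a ?k) \<bind> ?R"
  proof (rule bind_assoc[symmetric])
    have "sets \<mu> = sets M"
      using Suc.prems by (simp add: space_prob_algebra)
    then show "K a ?k \<in> \<mu> \<rightarrow>\<^sub>M subprob_algebra M"
      using measurable_prob_algebraD[OF K] by (simp cong: measurable_cong_sets)
    show "?R \<in> M \<rightarrow>\<^sub>M subprob_algebra M"
      by (rule measurable_prob_algebraD[OF measurable_run_stages[OF K]])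
  qed
  moreover have "P b ((\<mu> \<bind> K a ?k) \<bind> ?R)"
  proof (rule Suc.hyps(1))
    show "k = b - Suc a" "Suc a \<le> b"
      using Suc.hyps \<open>a < b\<close> by simp_all
    show "\<mu> \<bind> K a ?k \<in> space (prob_algebra M)"
      using Suc.prems(4) K[of a ?k] prob_space_bind'[of \<mu> M "K a ?k" M] sets_bind'[of \<mu> M "K a ?k" M]
      by (simp add: space_prob_algebra)
    show "P (Suc a) (\<mu> \<bind> K a ?k)"
      using Suc.prems \<open>a < b\<close> by simp
    show "n - ?k = (\<Sum>t=Suc a..<b. the_enat (\<tau> t))"
      using n by simp
  qed (use Suc.prems in auto)
  ultimately show ?case by simp
qed

theorem theorem3:
  fixes M :: "'a::real_vector measure"
    and \<F> :: "('a \<Rightarrow> real) set"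
    and d :: "'a \<Rightarrow> 'a \<Rightarrow> real"
    and A :: "'a alg"
    and lam \<Delta> \<epsilon> \<theta> :: real
  assumes "\<forall>F\<in>\<F>. convex_on (space M) F \<and> F \<in> borel_measurable M"
    and "lam > 0" and "\<Delta> > 0" and "\<epsilon> > 0"
    and "algorithm M \<F> A"
    and "\<theta> > 1"
  shows "opt_time_gc M lam \<epsilon> \<Delta> d \<F> (cvx_to_sc M lam d \<F> A \<theta>)
         \<le> (\<Sum>t = 1..nat \<lceil>log \<theta> (\<Delta> / \<epsilon>)\<rceil>.
               opt_time M (\<theta> powr (- real t) * \<Delta>) (\<theta> powr (1 - real t) * \<Delta> / lam) d \<F> A)"
proof -
  define T where "T = nat \<lceil>log \<theta> (\<Delta> / \<epsilon>)\<rceil>"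
  define e B where "e t = \<theta> powr (- real t) * \<Delta>" and "B t = \<theta> powr (1 - real t) * \<Delta> / lam"
    for t :: nat
  define \<tau> where "\<tau> t = opt_time M (e t) (B t) d \<F> A" for t
  define n where "n = (\<Sum>t=1..<Suc T. the_enat (\<tau> t))"
  \<comment> \<open>The accuracy reached by one stage, divided by \<open>lam\<close>, is the
    distance bound required by the next.\<close>
  have B_Suc: "B (Suc t) = e t / lam" for t
    by (simp add: B_def e_def)
  have e_T: "e T \<le> \<epsilon>"
  proof -
    \<comment> \<open>This also covers \<Delta> < \<epsilon>, where the logarithm is negative and
      \<open>nat\<close> truncates to \<open>T = 0\<close>.\<close>
    have "log \<theta> (\<Delta> / \<epsilon>) \<le> real T"
      unfolding T_def by linarith
    then have "\<Delta> / \<epsilon> \<le> \<theta> powr real T"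
      using assms by (simp add: log_le_iff)
    then show ?thesis
      using assms by (simp add: e_def powr_minus field_simps)
  qed
  have "opt_time_gc M lam \<epsilon> \<Delta> d \<F> (cvx_to_sc M lam d \<F> A \<theta>) \<le> (\<Sum>t=1..T. \<tau> t)"
  proof (cases "\<exists>t\<in>{1..T}. \<tau> t = \<infinity>")
    \<comment> \<open>A stage of infinite duration makes the right-hand side infinite.\<close>
    case True
    then have "(\<Sum>t=1..T. \<tau> t) = \<infinity>"
      by (metis finite_atLeastAtMost member_le_sum zero_le enat_ord_simps(5))
    then show ?thesis by simp
  next
    case False
    have fin: "\<tau> t \<noteq> \<infinity>" if "1 \<le> t" "t < Suc T" for t
      using False that by auto
    have "(\<Sum>t=1..T. \<tau> t) = (\<Sum>t=1..T. enat (the_enat (\<tau> t)))"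
      using False by (intro sum.cong refl) (metis not_infinity_eq the_enat.simps)
    also have "\<dots> = enat n"
      using sum_comp_morphism[of enat "\<lambda>t. the_enat (\<tau> t)" "{1..T}"]
      by (simp add: n_def comp_def zero_enat_def atLeastLessThanSuc_atLeastAtMost)
    finally have sum: "(\<Sum>t=1..T. \<tau> t) = enat n" .
    have "ext_expect (\<mu> \<bind> cvx_to_sc M lam d \<F> A \<theta> \<epsilon> \<Delta> F n) F
            - ereal (min_value (space M) F) \<le> ereal \<epsilon>"
      if F: "F \<in> \<F>" and \<mu>: "\<mu> \<in> space (prob_algebra M)" and gc: "growth_condition M lam d F"
        and sub: "ext_expect \<mu> F - ereal (min_value (space M) F) \<le> ereal \<Delta>" for F \<mu>
    proof -
      let ?K = "\<lambda>t. A (e t) (B t) F"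
      \<comment> \<open>Stages are numbered from 1, so stage \<open>t\<close> starts from accuracy
        \<open>e (t - 1)\<close>: \<open>?P 1\<close> is the hypothesis with \<open>e 0\<close> =
        \<Delta>, and \<open>?P (Suc T)\<close> bounds the output by \<open>e T\<close>.\<close>
      let ?P = "\<lambda>t \<mu>. ext_expect \<mu> F - ereal (min_value (space M) F) \<le> ereal (e (t - 1))"
      obtain xs where xs: "minimizer_map M d F xs"
        and growth: "\<And>x. x \<in> space M \<Longrightarrow> lam * d x (xs x) \<le> F x - min_value (space M) F"
        using gc unfolding growth_condition_def by auto
      have "?P (Suc T) (\<mu> \<bind> run_stages M \<tau> ?K [1..<Suc T] n)"
      proof (rule bind_run_stages_invariant[where P = ?P])
        fix t \<nu>
        assume t: "1 \<le> t" "t < Suc T" and \<nu>: "\<nu> \<in> space (prob_algebra M)" and P: "?P t \<nu>"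
        have "ext_expect \<nu> (\<lambda>x. d x (xs x)) \<le> ereal (B t)"
          using ext_expect_dist_le[OF \<nu> _ \<open>lam > 0\<close> xs growth P] assms(1) F t B_Suc[of "t - 1"]
          by simp
        \<comment> \<open>The minimal time is attained, so the defining property of
          \<open>opt_time\<close> applies to the run of stage \<open>t\<close>.\<close>
        moreover have "the_enat (\<tau> t) \<in> {n. \<forall>F\<in>\<F>. \<forall>xs. \<forall>\<mu>\<in>space (prob_algebra M).
            minimizer_map M d F xs \<and> ext_expect \<mu> (\<lambda>x. d x (xs x)) \<le> ereal (B t) \<longrightarrow>
            ext_expect (\<mu> \<bind> A (e t) (B t) F n) F - ereal (min_value (space M) F) \<le> ereal (e t)}"
          using fin[OF t] unfolding \<tau>_def opt_time_def by (rule the_enat_INF_in)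
        ultimately show "?P (Suc t) (\<nu> \<bind> ?K t (the_enat (\<tau> t)))"
          using F \<nu> xs by auto
      qed (use assms F \<mu> sub fin in \<open>auto simp: algorithm_def n_def e_def\<close>)
      moreover have "cvx_to_sc M lam d \<F> A \<theta> \<epsilon> \<Delta> F n = run_stages M \<tau> ?K [1..<Suc T] n"
        unfolding cvx_to_sc_def T_def[symmetric] e_def[symmetric] B_def[symmetric] \<tau>_def[symmetric] ..
      ultimately show ?thesis
        using e_T order_trans by fastforce
    qed
    then have "opt_time_gc M lam \<epsilon> \<Delta> d \<F> (cvx_to_sc M lam d \<F> A \<theta>) \<le> enat n"
      unfolding opt_time_gc_def by (intro INF_lower) auto
    then show ?thesis
      using sum by simp
  qed
  then show ?thesis
    by (simp add: T_def \<tau>_def e_def B_def)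
qed

end
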